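(* Let $n\ge 3$ and let $W_n$ be the wheel graph with central vertex $v_0$ and outer vertices $v_1,\dots,v_n$. Let $(\mathbf d,\mathbf r)$, with $\mathbf d=(d_0,\dots,d_n)$ and $\mathbf r=(r_0,\dots,r_n)$, be an arithmetical structure on $W_n$ such that $r_0\mid r_1+r_n$, $r_n\mid r_0$ and $r_1\mid r_0$. Then $W_{n+1}$ has an arithmetical structure $(\tilde{\mathbf d},\tilde{\mathbf r})$, $\tilde{\mathbf d}=(\tilde d_0,\dots,\tilde d_{n+1})$, $\tilde{\mathbf r}=(\tilde r_0,\dots,\tilde r_{n+1})$, given by $$\tilde d_i=\begin{cases}1 & \text{if } i=n+1,\\ d_i & \text{if } i\notin\{0,1,n,n+1\},\\ d_0+\dfrac{r_1+r_n+r_0}{r_0} & \text{if } i=0,\\ d_1+\dfrac{r_1+r_0}{r_1} & \text{if } i=1,\\ d_n+\dfrac{r_n+r_0}{r_n} & \text{if } i=n,\end{cases}\qquad \tilde r_i=\begin{cases} r_1+r_n+r_0 & \text{if } i=n+1,\\ r_i & \text{otherwise.}\end{cases}$$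
   Context: $\mathbb N$ denotes the positive integers. For a finite connected simple graph $G$ with vertex set $V$ and adjacency matrix $A$, an arithmetical structure on $G$ is a pair $(\mathbf d,\mathbf r)\in\mathbb N^V\times\mathbb N^V$ such that the gcd of the entries of $\mathbf r$ is $1$ and $(\operatorname{diag}(\mathbf d)-A)\mathbf r=0$, i.e. $d_vr_v=\sum_{u\sim v}r_u$ for every vertex $v$. For $m\ge 3$ the wheel graph $W_m$ has $m+1$ vertices $v_0,v_1,\dots,v_m$: the vertices $v_1,\dots,v_m$ form a cycle in this cyclic order ($v_i$ adjacent to $v_{i+1}$ for $1\le i<m$, and $v_m$ adjacent to $v_1$), and the central vertex $v_0$ is adjacent to all of $v_1,\dots,v_m$. Entries with index $i$ belong to $v_i$. *)

theory Defs
  imports Complex_Main "Graph_Theory.Graph_Theory"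
begin

text \<open>
  A finite simple graph is a finite symmetric loopless digraph without parallel arcs
  (\<open>pair_graph\<close>), so that every undirected edge is a pair of opposite arcs.
  Topological connectedness has the same base name as the graph-theoretic notion,
  hence the qualified \<open>Digraph_Component.connected\<close>.
\<close>

definition adj_matrix :: "'a pair_pre_digraph \<Rightarrow> 'a \<Rightarrow> 'a \<Rightarrow> int" where
  "adj_matrix G u v = (if (u, v) \<in> parcs G then 1 else 0)"

definition diag_matrix :: "('a \<Rightarrow> int) \<Rightarrow> 'a \<Rightarrow> 'a \<Rightarrow> int" where
  "diag_matrix d u v = (if u = v then d u else 0)"

text \<open>
  Vectors in \<open>\<nat>\<^sup>V\<close> are functions of which only the values on \<open>V = pverts G\<close> matter;
  the last conjunct is \<open>(diag(d) - A) r = 0\<close>, row by row, over the integers.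
\<close>

definition arithmetical_structure ::
    "'a pair_pre_digraph \<Rightarrow> ('a \<Rightarrow> nat) \<Rightarrow> ('a \<Rightarrow> nat) \<Rightarrow> bool" where
  "arithmetical_structure G d r \<longleftrightarrow>
     pair_graph G \<and> Digraph_Component.connected (with_proj G) \<and>
     (\<forall>v\<in>pverts G. 0 < d v \<and> 0 < r v) \<and>
     Gcd (r ` pverts G) = 1 \<and>
     (\<forall>v\<in>pverts G.
        (\<Sum>u\<in>pverts G. (diag_matrix (\<lambda>w. int (d w)) v u - adj_matrix G v u) * int (r u)) = 0)"

lemma row_zero_iff:
  assumes "pair_graph G" "v \<in> pverts G"
  shows "(\<Sum>u\<in>pverts G. (diag_matrix (\<lambda>w. int (d w)) v u - adj_matrix G v u) * int (r u)) = 0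
     \<longleftrightarrow> d v * r v = (\<Sum>u | (v, u) \<in> parcs G. r u)"
proof -
  interpret pair_graph G by fact
  have fin: "finite (pverts G)" by (rule pair_finite_verts)
  have nb: "{u \<in> pverts G. (v, u) \<in> parcs G} = {u. (v, u) \<in> parcs G}"
    using in_arcsD2 by auto
  have "(\<Sum>u\<in>pverts G. (diag_matrix (\<lambda>w. int (d w)) v u - adj_matrix G v u) * int (r u))
      = (\<Sum>u\<in>pverts G. if v = u then int (d v) * int (r u) else 0)
        - (\<Sum>u\<in>pverts G. if (v, u) \<in> parcs G then int (r u) else 0)"
    unfolding sum_subtractf[symmetric]
    by (rule sum.cong) (auto simp: diag_matrix_def adj_matrix_def left_diff_distrib)
  also have "\<dots> = int (d v * r v) - int (\<Sum>u | (v, u) \<in> parcs G. r u)"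
    using fin assms(2) by (simp add: sum.inter_filter[symmetric] nb)
  finally show ?thesis by linarith
qed

lemma arithmetical_structure_iff:
  "arithmetical_structure G d r \<longleftrightarrow>
     pair_graph G \<and> Digraph_Component.connected (with_proj G) \<and>
     (\<forall>v\<in>pverts G. 0 < d v \<and> 0 < r v) \<and>
     Gcd (r ` pverts G) = 1 \<and>
     (\<forall>v\<in>pverts G. d v * r v = (\<Sum>u | (v, u) \<in> parcs G. r u))"
  unfolding arithmetical_structure_def by (intro conj_cong refl ball_cong row_zero_iff)

text \<open>The wheel on the vertices \<open>0, \<dots>, m\<close> with centre \<open>0\<close>; meaningful for \<open>m \<ge> 3\<close>.\<close>

definition wheel :: "nat \<Rightarrow> nat pair_pre_digraph" where
  "wheel m =
     (let E = {(0, i) | i. 1 \<le> i \<and> i \<le> m} \<union> {(i, i + 1) | i. 1 \<le> i \<and> i < m} \<union> {(m, 1)}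
      in \<lparr> pverts = {0..m}, parcs = E \<union> E\<inverse> \<rparr>)"

lemma pair_graph_wheel:
  assumes "m \<ge> 3"
  shows "pair_graph (wheel m)"
proof -
  have sub: "parcs (wheel m) \<subseteq> {0..m} \<times> {0..m}"
    using assms by (auto simp: wheel_def Let_def)
  show ?thesis
  proof
    show "finite (parcs (wheel m))"
      by (rule finite_subset[OF sub]) simp
    show "symmetric (with_proj (wheel m))"
      unfolding symmetric_def wheel_def Let_def with_proj_simps pair_pre_digraph.simps
      by (rule sym_Un_converse)
  next
    fix e assume "e \<in> parcs (wheel m)"
    thus "fst e \<noteq> snd e" using assms by (auto simp: wheel_def Let_def)
  qed (use sub in \<open>auto simp: wheel_def Let_def\<close>)
qed

lemma connected_wheel:
  assumes "m \<ge> 3"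
  shows "Digraph_Component.connected (with_proj (wheel m))"
proof -
  interpret pair_graph "wheel m" by (rule pair_graph_wheel[OF assms])
  have out: "0 \<rightarrow>\<^sup>*\<^bsub>with_proj (wheel m)\<^esub> v" if "v \<in> pverts (wheel m)" for v
  proof (cases "v = 0")
    case False
    hence "(0, v) \<in> parcs (wheel m)" using that by (auto simp: wheel_def Let_def)
    thus ?thesis by (intro reachable_adjI) simp
  qed (use that in simp)
  have "strongly_connected (with_proj (wheel m))"
  proof (rule strongly_connectedI)
    fix u v assume uv: "u \<in> verts (with_proj (wheel m))" "v \<in> verts (with_proj (wheel m))"
    have "u \<rightarrow>\<^sup>*\<^bsub>with_proj (wheel m)\<^esub> 0"
      using out uv(1) by (simp add: symmetric_reachable[OF sym_arcs])
    thus "u \<rightarrow>\<^sup>*\<^bsub>with_proj (wheel m)\<^esub> v"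
      using out uv(2) reachable_trans by simp
  qed (simp add: wheel_def Let_def)
  thus ?thesis
    by (auto simp: Digraph_Component.connected_def strongly_connected_def
        reachable_mk_symmetric_eq[OF sym_arcs])
qed

end

theory Submission
  imports Defs
begin

text \<open>
  \<open>W\<^sub>n\<^sub>+\<^sub>1\<close> arises from \<open>W\<^sub>n\<close> by subdividing the rim edge
  between \<open>v\<^sub>n\<close> and \<open>v\<^sub>1\<close> by a new vertex, which is also joined to the centre. Its label is
  the sum of the labels of its three neighbours, so that its own equation holds with
  \<open>d = 1\<close>. Only these three neighbours see a change: the neighbour sum of the centre grows
  by the new label \<open>r\<^sub>1 + r\<^sub>n + r\<^sub>0\<close>, while \<open>v\<^sub>1\<close> and \<open>v\<^sub>n\<close> each gain the new label but lose each
  other, for a net gain of \<open>r\<^sub>1 + r\<^sub>0\<close> and \<open>r\<^sub>n + r\<^sub>0\<close> respectively. The divisibility assumptions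
  say exactly that each gain is a multiple of the label of the vertex concerned, so it is absorbed
  by raising \<open>d\<close> there by the quotient. The gcd stays \<open>1\<close> because all the old labels survive.

  The lemma \<open>arithmetical_structure_wheel_iff\<close> puts the equations into a form in which the vertices
  of the two wheels can be compared one by one.
\<close>

lemma wheel_neighbours_centre:
  "m \<ge> 3 \<Longrightarrow> {u. (0, u) \<in> parcs (wheel m)} = {1..m}"
  by (auto simp: wheel_def Let_def)

lemma wheel_neighbours_rim:
  assumes "m \<ge> 3" "i \<in> {1..m}"
  shows "{u. (i, u) \<in> parcs (wheel m)}
    = {0, if i = 1 then m else i - 1, if i = m then 1 else i + 1}"
  using assms by (auto simp: wheel_def Let_def)

text \<open>
  The rim equations are stated with cyclic predecessor and successor; for \<open>m \<ge> 3\<close> these two and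
  the centre are three distinct vertices, so the neighbour sum has three separate terms.
\<close>

lemma arithmetical_structure_wheel_iff:
  assumes "m \<ge> 3"
  shows "arithmetical_structure (wheel m) d r \<longleftrightarrow>
     (\<forall>i\<le>m. 0 < d i \<and> 0 < r i) \<and> Gcd (r ` {..m}) = 1 \<and>
     d 0 * r 0 = (\<Sum>i=1..m. r i) \<and>
     (\<forall>i\<in>{1..m}. d i * r i =
        r 0 + r (if i = 1 then m else i - 1) + r (if i = m then 1 else i + 1))"
proof -
  have rim: "(\<Sum>u | (i, u) \<in> parcs (wheel m). r u) =
      r 0 + r (if i = 1 then m else i - 1) + r (if i = m then 1 else i + 1)"
    if "i \<in> {1..m}" for i
    unfolding wheel_neighbours_rim[OF assms that] using assms that by auto
  have V: "pverts (wheel m) = {..m}"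
    by (auto simp: wheel_def Let_def)
  have split: "{..m} = insert 0 {1..m}"
    by auto
  have "(\<forall>v\<in>{..m}. d v * r v = (\<Sum>u | (v, u) \<in> parcs (wheel m). r u)) \<longleftrightarrow>
     d 0 * r 0 = (\<Sum>i=1..m. r i) \<and>
     (\<forall>i\<in>{1..m}. d i * r i =
        r 0 + r (if i = 1 then m else i - 1) + r (if i = m then 1 else i + 1))"
    unfolding split ball_simps wheel_neighbours_centre[OF assms]
    by (intro conj_cong refl ball_cong) (simp only: rim)
  thus ?thesis
    unfolding arithmetical_structure_iff V
    by (simp add: pair_graph_wheel[OF assms] connected_wheel[OF assms] Ball_def)
qed

theorem theorem4p5:
  fixes n :: nat and d r :: "nat \<Rightarrow> nat"
  assumes "n \<ge> 3"
    and "arithmetical_structure (wheel n) d r"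
    and "r 0 dvd r 1 + r n"
    and "r n dvd r 0"
    and "r 1 dvd r 0"
  shows "\<exists>d' r' :: nat \<Rightarrow> nat.
     arithmetical_structure (wheel (n + 1)) d' r' \<and>
     (\<forall>i \<le> n + 1. real (d' i) =
        (if i = n + 1 then 1
         else if i = 0 then real (d 0) + (real (r 1) + real (r n) + real (r 0)) / real (r 0)
         else if i = 1 then real (d 1) + (real (r 1) + real (r 0)) / real (r 1)
         else if i = n then real (d n) + (real (r n) + real (r 0)) / real (r n)
         else real (d i))) \<and>
     (\<forall>i \<le> n + 1. r' i = (if i = n + 1 then r 1 + r n + r 0 else r i))"
proof -
  define s where "s = r 1 + r n + r 0"
  define r' where "r' = r(n + 1 := s)"
  define d' where "d' = (\<lambda>i. if i = n + 1 then 1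
     else if i = 0 then d 0 + s div r 0
     else if i = 1 then d 1 + (r 1 + r 0) div r 1
     else if i = n then d n + (r n + r 0) div r n
     else d i)"
  have pos: "\<And>i. i \<le> n \<Longrightarrow> 0 < d i \<and> 0 < r i" and gcd: "Gcd (r ` {..n}) = 1"
    and centre: "d 0 * r 0 = (\<Sum>i=1..n. r i)"
    and rim: "\<And>i. i \<in> {1..n} \<Longrightarrow> d i * r i =
        r 0 + r (if i = 1 then n else i - 1) + r (if i = n then 1 else i + 1)"
    using assms(2) unfolding arithmetical_structure_wheel_iff[OF assms(1)] by auto
  have dvds: "r 0 dvd s" "r 1 dvd r 1 + r 0" "r n dvd r n + r 0"
    using assms(3-5) by (simp_all add: s_def)
  have "arithmetical_structure (wheel (n + 1)) d' r'"
  proof (subst arithmetical_structure_wheel_iff, goal_cases)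
    case 1
    show ?case using assms(1) by simp
  next
    case 2
    show ?case
    proof (intro conjI)
      show "\<forall>i\<le>n + 1. 0 < d' i \<and> 0 < r' i"
        using pos by (auto simp: d'_def r'_def s_def le_Suc_eq)
    next
      have "r' ` {..n + 1} = insert s (r ` {..n})"
        by (auto simp: r'_def image_def le_Suc_eq)
      thus "Gcd (r' ` {..n + 1}) = 1"
        using gcd by simp
    next
      have "(\<Sum>i=1..n + 1. r' i) = (\<Sum>i=1..n. r i) + s"
        by (simp add: r'_def)
      thus "d' 0 * r' 0 = (\<Sum>i=1..n + 1. r' i)"
        using centre dvds(1) by (simp add: d'_def r'_def distrib_right)
    next
      show "\<forall>i\<in>{1..n + 1}. d' i * r' i =
        r' 0 + r' (if i = 1 then n + 1 else i - 1) + r' (if i = n + 1 then 1 else i + 1)"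
      proof
        fix i assume i: "i \<in> {1..n + 1}"
        consider "i = n + 1" | "i = 1" | "i = n" | "1 < i" "i < n"
          using i by force
        thus "d' i * r' i =
          r' 0 + r' (if i = 1 then n + 1 else i - 1) + r' (if i = n + 1 then 1 else i + 1)"
        proof cases
          case 1
          thus ?thesis using assms(1) by (simp add: d'_def r'_def s_def)
        next
          case 2
          thus ?thesis using rim[of 1] dvds(2) assms(1)
            by (simp add: d'_def r'_def s_def distrib_right)
        next
          case 3
          moreover have "n - 1 \<noteq> n + 1" by arith
          ultimately show ?thesis using rim[of n] dvds(3) assms(1)
            by (simp add: d'_def r'_def s_def distrib_right)
        next
          case 4
          hence "i - 1 \<noteq> n + 1" by arith
          with 4 show ?thesis using rim[of i] by (simp add: d'_def r'_def)
        qed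
      qed
    qed
  qed
  moreover have "real (s div r 0) = (real (r 1) + real (r n) + real (r 0)) / real (r 0)"
    "real ((r 1 + r 0) div r 1) = (real (r 1) + real (r 0)) / real (r 1)"
    "real ((r n + r 0) div r n) = (real (r n) + real (r 0)) / real (r n)"
    using dvds[THEN real_of_nat_div] by (simp_all add: s_def)
  ultimately show ?thesis
    by (intro exI[of _ d'] exI[of _ r']) (auto simp: d'_def r'_def s_def)
qed

end
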